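(* Let $\alpha,\beta>-1$. For $n=0,1,\dots$, the determinant of the $(n+1)\times(n+1)$ matrix $$\left(\frac{(\alpha+1)_{i+j}}{(\alpha+\beta+2)_{i+j}}\right)_{0\le i,j\le n}$$ is $$\begin{aligned} \det\left(\frac{(\alpha+1)_{i+j}}{(\alpha+\beta+2)_{i+j}}\right)_{i,j=0}^{n} ={}&\frac{G\left(\frac{\alpha+\beta+1}{2}\right)^{2}G\left(\frac{\alpha+\beta+2}{2}\right)^{2}}{G(\alpha+1)\,G(\beta+1)\,G(\alpha+\beta+1)}\\ &\times\left(\frac{\pi\,\Gamma(\alpha+\beta+2)}{2^{2n+2\alpha+2\beta+1}\,\Gamma(\alpha+1)\,\Gamma(\beta+1)}\right)^{n+1}\\ &\times\frac{G(n+2)\,G(\alpha+n+1)\,G(\beta+n+1)\,G(\alpha+\beta+n+1)}{\left(\frac{\alpha+\beta+1}{2}\right)_{n+1}G\left(\frac{\alpha+\beta+1}{2}+n+1\right)^{2}G\left(\frac{\alpha+\beta+2}{2}+n+1\right)^{2}}, \end{aligned}$$ and its inverse matrix $(\gamma_{ij})_{0\le i,j\le n}$ has elements $$\begin{aligned} \gamma_{ij}={}&\frac{(-1)^{i+j}(\alpha+\beta+1)_{i}(\alpha+\beta+1)_{j}}{(\alpha+1)_{i}(\alpha+1)_{j}(\alpha+\beta+1)}\sum_{k=\max(i,j)}^{n}\frac{(2k+\alpha+\beta+1)(\alpha+1)_{k}}{k!\,(\alpha+\beta+1)_{k}(\beta+1)_{k}}\\ &\times\binom{k}{i}\binom{k}{j}(\alpha+\beta+i+1)_{k}(\alpha+\beta+j+1)_{k}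 \end{aligned}$$ for $i,j=0,1,\dots,n$.
   Context: $\Gamma$ is Euler's gamma function and $(a)_n=\Gamma(a+n)/\Gamma(a)$ is the shifted factorial. $G$ is the Barnes $G$-function, the entire function given by $G(z+1)=(2\pi)^{z/2}e^{-[z(z+1)+\gamma z^2]/2}\prod_{m=1}^{\infty}\left(1+\frac zm\right)^m e^{-z+z^2/(2m)}$ with $\gamma$ Euler's constant; it satisfies $G(z+1)=\Gamma(z)G(z)$ and $G(1)=1$.
   Formalization: The numerator factors G(α+n+1), G(β+n+1), G(α+β+n+1) are corrected to G(α+n+2), G(β+n+2), G(α+β+n+2) (as printed, n=0, α=β=1 gives 1/2, not 1); where α+β=-1 both formulas are 0/0 and are read as limits through α+β≠-1. *)

theory Defs
  imports
    "HOL-Analysis.Gamma_Function"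
    "HOL-Analysis.Infinite_Products"
    "Jordan_Normal_Form.Determinant"
begin

text \<open>
  The Barnes G-function. The classical product expresses \<open>G (w + 1)\<close> in terms of \<open>w\<close>; here
  \<open>w = z - 1\<close>, and \<open>m = 1, 2, \<dots>\<close> is written as \<open>Suc m\<close>. The type is generic so that the
  complex instance is the entire function and the real instance is its restriction to the
  real line, as for \<^const>\<open>Gamma\<close>.
\<close>
definition barnes_G :: "'a :: {real_normed_field, ln} \<Rightarrow> 'a" where
  "barnes_G z = (let w = z - 1 in
     of_real (2 * pi) powr (w / 2)
     * exp (- (w * (w + 1) + euler_mascheroni * w ^ 2) / 2)
     * (\<Prod>m. (1 + w / of_nat (Suc m)) ^ Suc m * exp (- w + w ^ 2 / (2 * of_nat (Suc m)))))"

definition jacobi_hankel :: "nat \<Rightarrow> real \<Rightarrow> real \<Rightarrow> real mat" where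
  "jacobi_hankel n \<alpha> \<beta> = mat (n + 1) (n + 1)
     (\<lambda>(i, j). pochhammer (\<alpha> + 1) (i + j) / pochhammer (\<alpha> + \<beta> + 2) (i + j))"

text \<open>
  The numerator of the last factor is \<open>G(n+2) G(\<alpha>+n+2) G(\<beta>+n+2) G(\<alpha>+\<beta>+n+2)\<close>. One also finds
  the arguments \<open>\<alpha>+n+1\<close>, \<open>\<beta>+n+1\<close>, \<open>\<alpha>+\<beta>+n+1\<close> printed for the last three, which cannot be
  right: by \<open>G(z+1) = \<Gamma>(z) G(z)\<close> that expression is smaller by the factor
  \<open>\<Gamma>(\<alpha>+n+1) \<Gamma>(\<beta>+n+1) \<Gamma>(\<alpha>+\<beta>+n+1)\<close>, so for \<open>n = 0\<close> and \<open>\<alpha> = \<beta> = 1\<close> it is \<open>1/2\<close>, whereas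
  the \<open>1 \<times> 1\<close> determinant is \<open>1\<close>. The shifted arguments are the ones that come from
  \<open>(\<Prod>k\<le>n. (a)\<^sub>k) = G(a+n+1) / (G(a) \<Gamma>(a)^(n+1))\<close> with \<open>a = \<alpha>+1, \<beta>+1, \<alpha>+\<beta>+1\<close>.
\<close>
definition jacobi_det_formula :: "nat \<Rightarrow> real \<Rightarrow> real \<Rightarrow> real" where
  "jacobi_det_formula n \<alpha> \<beta> =
     barnes_G ((\<alpha> + \<beta> + 1) / 2) ^ 2 * barnes_G ((\<alpha> + \<beta> + 2) / 2) ^ 2
       / (barnes_G (\<alpha> + 1) * barnes_G (\<beta> + 1) * barnes_G (\<alpha> + \<beta> + 1))
     * (pi * Gamma (\<alpha> + \<beta> + 2)
          / (2 powr (2 * real n + 2 * \<alpha> + 2 * \<beta> + 1) * Gamma (\<alpha> + 1) * Gamma (\<beta> + 1))) ^ (n + 1)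
     * (barnes_G (real n + 2) * barnes_G (\<alpha> + real n + 2) * barnes_G (\<beta> + real n + 2)
          * barnes_G (\<alpha> + \<beta> + real n + 2)
        / (pochhammer ((\<alpha> + \<beta> + 1) / 2) (n + 1)
           * barnes_G ((\<alpha> + \<beta> + 1) / 2 + real n + 1) ^ 2
           * barnes_G ((\<alpha> + \<beta> + 2) / 2 + real n + 1) ^ 2))"

definition jacobi_inverse_formula :: "nat \<Rightarrow> nat \<Rightarrow> nat \<Rightarrow> real \<Rightarrow> real \<Rightarrow> real" where
  "jacobi_inverse_formula n i j \<alpha> \<beta> =
     (-1) ^ (i + j) * pochhammer (\<alpha> + \<beta> + 1) i * pochhammer (\<alpha> + \<beta> + 1) j
       / (pochhammer (\<alpha> + 1) i * pochhammer (\<alpha> + 1) j * (\<alpha> + \<beta> + 1))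
     * (\<Sum>k = max i j..n.
          (2 * real k + \<alpha> + \<beta> + 1) * pochhammer (\<alpha> + 1) k
            / (fact k * pochhammer (\<alpha> + \<beta> + 1) k * pochhammer (\<beta> + 1) k)
          * real (k choose i) * real (k choose j)
          * pochhammer (\<alpha> + \<beta> + real i + 1) k * pochhammer (\<alpha> + \<beta> + real j + 1) k)"

text \<open>
  Both formulas have the form \<open>0/0\<close> on the line \<open>\<alpha> + \<beta> = -1\<close> (since \<open>G 0 = 0\<close> and
  \<open>(0)\<^sub>k = 0\<close> for \<open>k > 0\<close>), where they are read as their continuous extension in \<open>(\<alpha>, \<beta>)\<close>;
  with the convention \<open>x / 0 = 0\<close> plain equality would be false there. Off that line the
  relation below is plain equality.
\<close>
definition has_extended_value :: "(real \<Rightarrow> real \<Rightarrow> real) \<Rightarrow> real \<Rightarrow> real \<Rightarrow> real \<Rightarrow> bool" where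
  "has_extended_value f \<alpha> \<beta> v \<longleftrightarrow>
     (if \<alpha> + \<beta> \<noteq> -1 then v = f \<alpha> \<beta>
      else ((\<lambda>(a, b). f a b) \<longlongrightarrow> v) (at (\<alpha>, \<beta>) within {(a, b). a + b \<noteq> -1}))"

end

(*
  The entries of the matrix are the moments of a Beta distribution, so it is diagonalized by the
  Jacobi polynomials p_k = sum_i L_ki x^i, L_ki = (-1)^i C(k,i) (s+k)_i / (a)_i, where a = alpha+1 and
  s = alpha+beta+1: one has L H L^T = D with D = diag (h_k), hence H^-1 = L^T D^-1 L and
  det H = prod_k h_k / L_kk^2. Orthogonality reduces to the fact that k-th differences kill
  polynomials of degree < k, because (s+k)_j / (s+1)_(i+j) = (s+1+i+j)_(k-1-i) / (s+1)_(k-1).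
  The norm h_k arises in the same way from the remainder of (a+j)_k modulo s+k+j.

  The Barnes form of the determinant follows from the duplication formulas for (s)_(2k) and Gamma and
  from the functional equation G(z+1) = Gamma(z) G(z), which is obtained by comparing the partial
  products of G(z+1) and G(z) with the Gauss product for Gamma(z) and Stirling's formula.
  Since h_k and L_ki are continuous in (alpha,beta) also where s = 0, the values there are the limits.
*)
theory Submission
  imports Defs "HOL-Real_Asymp.Real_Asymp"
begin

section \<open>The Barnes G-function on the real line\<close>

definition barnes_factor :: "real \<Rightarrow> nat \<Rightarrow> real" where
  "barnes_factor w m =
     (1 + w / real (Suc m)) ^ Suc m * exp (- w + w\<^sup>2 / (2 * real (Suc m)))"

text \<open>Taylor bounds are stated at the punctured filter \<open>at a\<close>; substituting a
  sequence that may take the value \<open>a\<close> itself needs \<open>nhds a\<close>.\<close>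

lemma bigo_nhds_if_bigo_at:
  assumes "f \<in> O[at a](g)" and "f a = 0"
  shows "f \<in> O[nhds a](g)"
proof -
  obtain c where c: "c > 0" "eventually (\<lambda>x. norm (f x) \<le> c * norm (g x)) (at a)"
    using assms(1) by (elim landau_o.bigE)
  then have "eventually (\<lambda>x. norm (f x) \<le> c * norm (g x)) (nhds a)"
    using assms(2) by (auto simp: eventually_nhds_conv_at)
  then show ?thesis
    by (rule landau_o.bigI[OF c(1)])
qed

text \<open>The exponential cancels the first two Taylor terms of
  \<open>ln (1 + w / real (Suc m))\<close>, so the logarithm of a late factor is of order
  \<open>1 / m^2\<close> and the product converges absolutely.\<close>

lemma convergent_prod_barnes_factor: "convergent_prod (barnes_factor w)"
proof -
  define x where "x m = w / real (Suc m)" for m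
  define y where "y m = real (Suc m) * (ln (1 + x m) - x m + (x m)\<^sup>2 / 2)" for m
  have x0: "x \<longlonglongrightarrow> 0"
    unfolding x_def by real_asymp
  have "(\<lambda>t::real. ln (1 + t) - t + t\<^sup>2 / 2) \<in> O[at 0](\<lambda>t. t ^ 3)"
    by real_asymp
  then have "(\<lambda>t::real. ln (1 + t) - t + t\<^sup>2 / 2) \<in> O[nhds 0](\<lambda>t. t ^ 3)"
    by (rule bigo_nhds_if_bigo_at) simp
  then have "(\<lambda>m. ln (1 + x m) - x m + (x m)\<^sup>2 / 2) \<in> O(\<lambda>m. x m ^ 3)"
    by (rule landau_o.big.compose[OF _ x0])
  then have "y \<in> O(\<lambda>m. real (Suc m) * x m ^ 3)"
    unfolding y_def by (rule landau_o.big.mult[OF landau_o.big_refl])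
  also have "(\<lambda>m. real (Suc m) * x m ^ 3) \<in> O(\<lambda>m. w ^ 3 * (1 / real m ^ 2))"
  proof -
    have "(\<lambda>m. real (Suc m) * x m ^ 3) = (\<lambda>m. w ^ 3 * (1 / real (Suc m) ^ 2))"
      by (simp add: x_def fun_eq_iff power2_eq_square power3_eq_cube del: of_nat_Suc)
    moreover have "(\<lambda>m. 1 / real (Suc m) ^ 2) \<in> O(\<lambda>m. 1 / real m ^ 2)"
      by real_asymp
    ultimately show ?thesis
      by (simp only:) (intro landau_o.big.mult landau_o.big_refl)
  qed
  also have "(\<lambda>m. w ^ 3 * (1 / real m ^ 2)) \<in> O(\<lambda>m. 1 / real m ^ 2)"
    by (simp only: cmult_in_bigo_iff landau_o.big_refl simp_thms)
  finally have y_bigo: "y \<in> O(\<lambda>m. 1 / real m ^ 2)" .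
  also have "(\<lambda>m. 1 / real m ^ 2) \<in> o(\<lambda>_. 1)"
    by real_asymp
  finally have "y \<longlonglongrightarrow> 0"
    using smalloD_tendsto[of y _ "\<lambda>_. 1"] by simp
  moreover have "(\<lambda>t::real. exp t - 1) \<in> O[at 0](\<lambda>t. t)"
    by real_asymp
  then have "(\<lambda>t::real. exp t - 1) \<in> O[nhds 0](\<lambda>t. t)"
    by (rule bigo_nhds_if_bigo_at) simp
  ultimately have "(\<lambda>m. exp (y m) - 1) \<in> O(y)"
    using landau_o.big.compose by blast
  also note y_bigo
  \<comment> \<open>For negative \<open>w\<close>, \<open>1 + x m\<close> can be nonpositive at
    finitely many \<open>m\<close>; the logarithmic form of the factor is used only beyond
    these.\<close>
  also have "eventually (\<lambda>m. 1 + x m > 0) sequentially"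
    unfolding x_def by real_asymp
  then have "eventually (\<lambda>m. exp (y m) - 1 = barnes_factor w m - 1) sequentially"
  proof eventually_elim
    case (elim m)
    have "(1 + x m) ^ Suc m = exp (real (Suc m) * ln (1 + x m))"
      by (metis elim exp_ln exp_of_nat_mult)
    moreover have "y m = real (Suc m) * ln (1 + x m) + (- w + w\<^sup>2 / (2 * real (Suc m)))"
    proof -
      have "t * (l - w / t + (w / t)\<^sup>2 / 2) = t * l + (- w + w\<^sup>2 / (2 * t))" if "t > 0" for t l :: real
        using that by (simp add: field_simps power2_eq_square)
      then show ?thesis
        unfolding y_def x_def by simp
    qed
    ultimately show ?case
      unfolding barnes_factor_def x_def by (simp only: exp_add)
  qed
  then have "(\<lambda>m. exp (y m) - 1) \<in> O(\<lambda>m. 1 / real m ^ 2)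
      \<longleftrightarrow> (\<lambda>m. barnes_factor w m - 1) \<in> O(\<lambda>m. 1 / real m ^ 2)"
    by (rule landau_o.big.in_cong)
  finally have "(\<lambda>m. barnes_factor w m - 1) \<in> O(\<lambda>m. 1 / real m ^ 2)" .
  moreover have "summable (\<lambda>m. norm (1 / real m ^ 2))"
    using inverse_power_summable[of 2, where 'a = real] by (simp add: field_simps)
  ultimately have "summable (\<lambda>m. norm (barnes_factor w m - 1))"
    using summable_comparison_test_bigo[of "\<lambda>m. 1 / real m ^ 2" "\<lambda>m. norm (barnes_factor w m - 1)"] by simp
  then show ?thesis
    by (intro abs_convergent_prod_imp_convergent_prod summable_imp_abs_convergent_prod)
qed

definition barnes_pprod :: "real \<Rightarrow> nat \<Rightarrow> real" where
  "barnes_pprod w n = (\<Prod>m<n. barnes_factor w m)"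

lemma barnes_factor_eq_0_iff: "barnes_factor w m = 0 \<longleftrightarrow> w = - real (Suc m)"
proof -
  have "1 + w / real (Suc m) = 0 \<longleftrightarrow> w = - real (Suc m)"
    by (auto simp: field_simps)
  then show ?thesis
    by (auto simp: barnes_factor_def simp del: of_nat_Suc)
qed

lemma barnes_pprod_LIMSEQ: "barnes_pprod w \<longlonglongrightarrow> prodinf (barnes_factor w)"
  unfolding barnes_pprod_def
  using convergent_prod_has_prod[OF convergent_prod_barnes_factor] by (rule has_prod_imp_tendsto')

lemma barnes_G_real:
  "barnes_G (z + 1 :: real) = (2 * pi) powr (z / 2)
     * exp (- (z * (z + 1) + euler_mascheroni * z ^ 2) / 2) * prodinf (barnes_factor z)"
  unfolding barnes_G_def Let_def barnes_factor_def by simp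

text \<open>A product that converges in the sense of \<open>convergent_prod\<close> vanishes only if
  one of its factors does.\<close>

lemma barnes_G_nonzero:
  fixes z :: real
  assumes "z \<notin> \<int>\<^sub>\<le>\<^sub>0"
  shows "barnes_G z \<noteq> 0"
proof -
  have "z \<noteq> - real m" for m
    using assms by auto
  then have "barnes_factor (z - 1) m \<noteq> 0" for m
    by (auto simp: barnes_factor_eq_0_iff)
  then have "prodinf (barnes_factor (z - 1)) \<noteq> 0"
    by (intro prodinf_nonzero convergent_prod_barnes_factor)
  then show ?thesis
    using barnes_G_real[of "z - 1"] by simp
qed

lemma barnes_G_1: "barnes_G (1 :: real) = 1"
proof -
  have "barnes_factor 0 = (\<lambda>_. 1)"
    by (simp add: barnes_factor_def fun_eq_iff)
  then show ?thesis
    using barnes_G_real[of 0] by simp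
qed

text \<open>A finite form of the functional equation. The quotients
  \<open>((m + 1 + z) / (m + z)) ^ (m + 1)\<close> telescope to
  \<open>(n + z) ^ n / pochhammer z n\<close>; the exponentials contribute \<open>exp (- n)\<close>
  and the harmonic sum.\<close>

lemma barnes_pprod_ratio:
  assumes "z \<notin> \<int>\<^sub>\<le>\<^sub>0"
  shows "barnes_pprod z n * (pochhammer z n * exp (real n))
       = barnes_pprod (z - 1) n * ((real n + z) ^ n * exp ((z - 1/2) * harm n))"
proof (induction n)
  case (Suc n)
  have nz: "z + real n \<noteq> 0"
    using assms plus_of_nat_eq_0_imp by blast
  have 1: "barnes_factor z n * (z + real n) ^ Suc n * exp 1
      = barnes_factor (z - 1) n * (real (Suc n) + z) ^ Suc n * exp ((z - 1/2) * inverse (real (Suc n)))"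
  proof -
    have "1 + z / real (Suc n) = (real (Suc n) + z) / real (Suc n)"
      and "1 + (z - 1) / real (Suc n) = (z + real n) / real (Suc n)"
      by (simp_all add: field_simps)
    moreover have "exp (- z + z\<^sup>2 / (2 * real (Suc n))) * exp 1 =
       exp (- (z - 1) + (z - 1)\<^sup>2 / (2 * real (Suc n))) * exp ((z - 1/2) * inverse (real (Suc n)))"
    proof -
      have "- z + z\<^sup>2 / (2 * x) + 1 = - (z - 1) + (z - 1)\<^sup>2 / (2 * x) + (z - 1/2) * inverse x"
        if "x > 0" for x :: real
        using that by (simp add: field_simps power2_eq_square)
      from this[of "real (Suc n)"] show ?thesis
        unfolding exp_add[symmetric] by simp
    qed
    ultimately show ?thesis
      unfolding barnes_factor_def by (simp add: power_divide mult_ac)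
  qed
  \<comment> \<open>The extra factor \<open>(z + real n) ^ n\<close> lets the step avoid quotients;
    it is cancelled at the end by \<open>nz\<close>.\<close>
  have "(barnes_pprod z (Suc n) * (pochhammer z (Suc n) * exp (real (Suc n)))) * (z + real n) ^ n
      = (barnes_pprod z n * (pochhammer z n * exp (real n)))
        * (barnes_factor z n * (z + real n) ^ Suc n * exp 1)"
    by (simp add: barnes_pprod_def pochhammer_Suc exp_add mult_ac)
  also have "\<dots> = (barnes_pprod (z - 1) n * ((real n + z) ^ n * exp ((z - 1/2) * harm n)))
        * (barnes_factor (z - 1) n * (real (Suc n) + z) ^ Suc n * exp ((z - 1/2) * inverse (real (Suc n))))"
    unfolding 1 Suc.IH ..
  also have "\<dots> = barnes_pprod (z - 1) (Suc n) * ((real (Suc n) + z) ^ Suc n * exp ((z - 1/2) * harm (Suc n)))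
        * (z + real n) ^ n"
    by (simp add: barnes_pprod_def harm_Suc exp_add distrib_left mult_ac add_ac)
  finally show ?case
    using nz by simp
qed (simp_all add: barnes_pprod_def harm_def)

section \<open>Stirling's formula and the functional equation of the Barnes function\<close>

definition stirling_ratio :: "nat \<Rightarrow> real" where
  "stirling_ratio n = fact n / (sqrt (real n) * real n ^ n * exp (- real n))"

text \<open>Arranged for the limit: \<open>Gamma_series'\<close> tends to \<open>Gamma z\<close>,
  \<open>(1 + z / n) ^ n\<close> to \<open>exp z\<close> and \<open>harm n - ln n\<close> to Euler's
  constant; the remaining growth in \<open>n\<close> is gathered in
  \<open>stirling_ratio\<close>.\<close>

lemma barnes_pprod_ratio':
  assumes z: "z \<notin> \<int>\<^sub>\<le>\<^sub>0" and n: "n > 0"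
  shows "barnes_pprod z n * stirling_ratio n = barnes_pprod (z - 1) n
       * (Gamma_series' z n * (1 + z / real n) ^ n * exp ((z - 1/2) * (harm n - ln (real n))))"
proof -
  have p: "pochhammer z n \<noteq> 0"
    using z by (auto dest: pochhammer_eq_0_imp_nonpos_Int)
  \<comment> \<open>The power \<open>n^z\<close> of the Gauss product, against the
    \<open>n^(z - 1/2)\<close> removed together with \<open>harm n\<close>, leaves
    \<open>sqrt n\<close>.\<close>
  have e: "exp (z * ln (real n)) * exp ((z - 1/2) * (harm n - ln (real n))) = sqrt (real n) * exp ((z - 1/2) * harm n)"
  proof -
    have "sqrt (real n) = exp (ln (real n) / 2)"
      using n by (simp add: ln_sqrt [symmetric])
    then show ?thesis
      by (simp add: exp_add[symmetric] algebra_simps)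
  qed
  \<comment> \<open>\<open>Gamma_series'\<close> contains \<open>fact (n - 1)\<close>; the factor
    \<open>n\<close> split off here becomes two square roots, one of which cancels.\<close>
  have f: "fact n = real n * fact (n - 1)"
    using n by (simp add: fact_reduce)
  have q: "(1 + z / real n) ^ n * real n ^ n = (real n + z) ^ n"
    using n by (simp add: power_mult_distrib[symmetric] field_simps)
  have "barnes_pprod z n * stirling_ratio n = (barnes_pprod z n * (pochhammer z n * exp (real n)))
      * (fact n / (sqrt (real n) * real n ^ n * pochhammer z n))"
    using p by (simp add: stirling_ratio_def exp_minus field_simps)
  also have "\<dots> = barnes_pprod (z - 1) n * ((real n + z) ^ n * exp ((z - 1/2) * harm n))
      * (fact n / (sqrt (real n) * real n ^ n * pochhammer z n))"
    unfolding barnes_pprod_ratio[OF z] ..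
  also have "\<dots> = barnes_pprod (z - 1) n * ((1 + z / real n) ^ n * real n ^ n * exp ((z - 1/2) * harm n))
      * (sqrt (real n) * sqrt (real n) * fact (n - 1) / (sqrt (real n) * real n ^ n * pochhammer z n))"
    unfolding q f by simp
  also have "\<dots> = barnes_pprod (z - 1) n * ((1 + z / real n) ^ n * (sqrt (real n) * exp ((z - 1/2) * harm n)))
      * (fact (n - 1) / pochhammer z n)"
    using n p by (simp add: field_simps del: real_sqrt_mult_self)
  finally show ?thesis
    unfolding e[symmetric] Gamma_series'_def by simp
qed

text \<open>
  Since \<open>barnes_pprod 0 n = 1\<close>, the previous identity at \<open>z = 1\<close> turns convergence of the Barnes
  product into Stirling's formula up to the constant.
\<close>
lemma stirling_ratio_convergent: "\<exists>T. T \<noteq> 0 \<and> stirling_ratio \<longlonglongrightarrow> T"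
proof -
  have nz: "prodinf (barnes_factor 1) \<noteq> 0"
    by (intro prodinf_nonzero convergent_prod_barnes_factor) (simp add: barnes_factor_eq_0_iff)
  define f where "f n = Gamma_series' 1 n * (1 + 1 / real n) ^ n * exp ((1 - 1/2) * (harm n - ln (real n)))" for n
  have one: "barnes_pprod 0 n = 1" for n
    by (simp add: barnes_pprod_def barnes_factor_def)
  have p: "eventually (\<lambda>n. barnes_pprod 1 n \<noteq> 0) sequentially"
    using barnes_pprod_LIMSEQ nz by (rule tendsto_imp_eventually_ne)
  have ev: "eventually (\<lambda>n. f n / barnes_pprod 1 n = stirling_ratio n) sequentially"
    using p eventually_gt_at_top[of 0]
  proof eventually_elim
    case (elim n)
    then show ?case
      using barnes_pprod_ratio'[of 1 n] by (simp add: one f_def field_simps)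
  qed
  have "(\<lambda>n. (1 + 1 / real n) ^ n) \<longlonglongrightarrow> exp 1"
    by (rule tendsto_exp_limit_sequentially)
  then have "f \<longlonglongrightarrow> Gamma 1 * exp 1 * exp ((1 - 1/2) * euler_mascheroni)"
    unfolding f_def by (intro tendsto_intros Gamma_series'_LIMSEQ euler_mascheroni_LIMSEQ)
  then have "(\<lambda>n. f n / barnes_pprod 1 n) \<longlonglongrightarrow>
      Gamma 1 * exp 1 * exp ((1 - 1/2) * euler_mascheroni) / prodinf (barnes_factor 1)"
    by (rule tendsto_divide[OF _ barnes_pprod_LIMSEQ nz])
  then have "stirling_ratio \<longlonglongrightarrow>
      Gamma 1 * exp 1 * exp ((1 - 1/2) * euler_mascheroni) / prodinf (barnes_factor 1)"
    by (rule Lim_transform_eventually[OF _ ev])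
  then show ?thesis
    using nz by (intro exI conjI) auto
qed

text \<open>
  The constant is identified from \<open>stirling_ratio n ^ 2 / stirling_ratio (2 * n)\<close>, which is
  \<open>sqrt 2\<close> times the Gauss product for \<open>Gamma (1/2)\<close>.
\<close>
lemma stirling_ratio_LIMSEQ: "stirling_ratio \<longlonglongrightarrow> sqrt (2 * pi)"
proof -
  obtain T where T: "T \<noteq> 0" "stirling_ratio \<longlonglongrightarrow> T"
    using stirling_ratio_convergent by blast
  have "filterlim (\<lambda>n::nat. 2 * n) sequentially sequentially"
    by real_asymp
  then have "(\<lambda>n. stirling_ratio (2 * n)) \<longlonglongrightarrow> T"
    by (rule filterlim_compose[OF T(2)])
  then have 1: "(\<lambda>n. stirling_ratio n * stirling_ratio n / stirling_ratio (2 * n)) \<longlonglongrightarrow> T * T / T"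
    using T by (intro tendsto_intros) auto
  have ev: "eventually (\<lambda>n. sqrt 2 * Gamma_series' (1/2) n =
      stirling_ratio n * stirling_ratio n / stirling_ratio (2 * n)) sequentially"
    using eventually_gt_at_top[of 0]
  proof eventually_elim
    case (elim n)
    have f: "fact n = real n * fact (n - 1)"
      using elim by (simp add: fact_reduce)
    have d: "fact (2 * n) = (4 ^ n * pochhammer (1 / 2) n * fact n :: real)"
      using fact_double[of n, where 'a = real] by (simp add: power_mult)
    have p: "pochhammer (1 / 2 :: real) n > 0"
      by (intro pochhammer_pos) simp
    have e: "exp (1 / 2 * ln (real n)) = sqrt (real n)"
      using elim by (simp add: powr_half_sqrt[symmetric] powr_def)
    have q: "(2 * real n) ^ (2 * n) = 4 ^ n * (real n ^ n * real n ^ n)"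
      by (simp add: power_mult_distrib power_mult power2_eq_square)
    have ex: "exp (- real (2 * n)) = exp (- real n) * exp (- real n)"
      by (simp add: exp_add[symmetric])
    have "stirling_ratio n * stirling_ratio n / stirling_ratio (2 * n)
       = fact n * fact n * (sqrt 2 * sqrt (real n) * (4 ^ n * (real n ^ n * real n ^ n)) * (exp (- real n) * exp (- real n)))
         / ((sqrt (real n) * sqrt (real n)) * (real n ^ n * real n ^ n) * (exp (- real n) * exp (- real n)) * fact (2 * n))"
      unfolding stirling_ratio_def ex unfolding of_nat_mult of_nat_numeral q real_sqrt_mult
      by (simp only: times_divide_eq_left times_divide_eq_right divide_divide_eq_left divide_divide_eq_right mult_ac)
    also have "\<dots> = fact n * fact n * (sqrt 2 * sqrt (real n) * 4 ^ n) / (real n * fact (2 * n))"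
      using elim by (simp add: divide_simps)
    also have "\<dots> = fact n * (sqrt 2 * sqrt (real n)) / (real n * pochhammer (1 / 2) n)"
      unfolding d using p elim by (simp add: divide_simps)
    also have "\<dots> = sqrt 2 * (fact (n - 1) * sqrt (real n) / pochhammer (1 / 2) n)"
      unfolding f using p elim by (simp add: divide_simps)
    finally show ?case
      unfolding Gamma_series'_def using e by simp
  qed
  have "(\<lambda>n. sqrt 2 * Gamma_series' (1/2) n) \<longlonglongrightarrow> sqrt 2 * Gamma (1/2 :: real)"
    by (intro tendsto_intros Gamma_series'_LIMSEQ)
  then have "(\<lambda>n. stirling_ratio n * stirling_ratio n / stirling_ratio (2 * n)) \<longlonglongrightarrow> sqrt 2 * Gamma (1/2)"
    by (rule Lim_transform_eventually[OF _ ev])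
  from LIMSEQ_unique[OF 1 this] have "T = sqrt (2 * pi)"
    using T by (simp add: Gamma_one_half_real real_sqrt_mult)
  with T show ?thesis by simp
qed

text \<open>Both sides of \<open>barnes_pprod_ratio'\<close> converge, so uniqueness of limits
  relates the infinite products at \<open>z\<close> and \<open>z - 1\<close>; what remains is to
  compare the prefactors.\<close>

lemma barnes_G_plus1:
  fixes z :: real
  assumes z: "z \<notin> \<int>\<^sub>\<le>\<^sub>0"
  shows "barnes_G (z + 1) = Gamma z * barnes_G z"
proof -
  let ?P = "\<lambda>w. prodinf (barnes_factor w)"
  let ?e = "exp z * exp ((z - 1/2) * euler_mascheroni)"
  have "(\<lambda>n. (1 + z / real n) ^ n) \<longlonglongrightarrow> exp z"
    by (rule tendsto_exp_limit_sequentially)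
  then have 1: "(\<lambda>n. barnes_pprod (z - 1) n
       * (Gamma_series' z n * (1 + z / real n) ^ n * exp ((z - 1/2) * (harm n - ln (real n)))))
      \<longlonglongrightarrow> ?P (z - 1) * (Gamma z * exp z * exp ((z - 1/2) * euler_mascheroni))"
    by (intro tendsto_intros Gamma_series'_LIMSEQ euler_mascheroni_LIMSEQ barnes_pprod_LIMSEQ)
  have "eventually (\<lambda>n. barnes_pprod z n * stirling_ratio n = barnes_pprod (z - 1) n
       * (Gamma_series' z n * (1 + z / real n) ^ n * exp ((z - 1/2) * (harm n - ln (real n))))) sequentially"
    using eventually_gt_at_top[of 0] by eventually_elim (rule barnes_pprod_ratio'[OF z])
  moreover have "(\<lambda>n. barnes_pprod z n * stirling_ratio n) \<longlonglongrightarrow> ?P z * sqrt (2 * pi)"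
    by (intro tendsto_intros stirling_ratio_LIMSEQ barnes_pprod_LIMSEQ)
  ultimately have "(\<lambda>n. barnes_pprod (z - 1) n
       * (Gamma_series' z n * (1 + z / real n) ^ n * exp ((z - 1/2) * (harm n - ln (real n)))))
      \<longlonglongrightarrow> ?P z * sqrt (2 * pi)"
    by (rule Lim_transform_eventually[rotated])
  from LIMSEQ_unique[OF this 1]
  have 2: "?P z * sqrt (2 * pi) = ?P (z - 1) * (Gamma z * ?e)"
    by (simp add: mult_ac)
  have 3: "(2 * pi) powr (z / 2) = (2 * pi) powr ((z - 1) / 2) * sqrt (2 * pi)"
    by (simp add: powr_half_sqrt[symmetric] powr_add[symmetric] field_simps)
  \<comment> \<open>\<open>?e\<close> is exactly the change of the quadratic exponent from
    \<open>z\<close> to \<open>z - 1\<close>; the Stirling constant is matched by the power of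
    \<open>2 * pi\<close> in \<open>3\<close>.\<close>
  have 4: "exp (- (z * (z + 1) + euler_mascheroni * z ^ 2) / 2) * ?e
      = exp (- ((z - 1) * (z - 1 + 1) + euler_mascheroni * (z - 1) ^ 2) / 2)"
    unfolding exp_add[symmetric] by (simp add: field_simps power2_eq_square)
  have "barnes_G (z + 1) = (2 * pi) powr ((z - 1) / 2)
     * exp (- (z * (z + 1) + euler_mascheroni * z ^ 2) / 2) * (?P z * sqrt (2 * pi))"
    unfolding barnes_G_real 3 by (simp add: mult_ac)
  also have "\<dots> = (2 * pi) powr ((z - 1) / 2)
     * (exp (- (z * (z + 1) + euler_mascheroni * z ^ 2) / 2) * ?e) * (?P (z - 1) * Gamma z)"
    unfolding 2 by (simp add: mult_ac)
  also have "\<dots> = Gamma z * barnes_G z"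
    unfolding 4 using barnes_G_real[of "z - 1"] by (simp add: mult_ac)
  finally show ?thesis .
qed

lemma nonpos_Ints_of_nat_add: "z + of_nat n \<in> \<int>\<^sub>\<le>\<^sub>0 \<Longrightarrow> (z :: real) \<in> \<int>\<^sub>\<le>\<^sub>0"
  using nonpos_Ints_diff_Nats[of "z + of_nat n" "of_nat n"] by simp

text \<open>Each factor is \<open>Gamma (a + k) / Gamma a\<close>, and \<open>Gamma (a + k)\<close>
  is a quotient of consecutive Barnes values, so the product telescopes.\<close>

lemma prod_pochhammer_barnes_G:
  fixes a :: real
  assumes a: "a \<notin> \<int>\<^sub>\<le>\<^sub>0"
  shows "(\<Prod>k\<le>n. pochhammer a k) = barnes_G (a + real n + 1) / (barnes_G a * Gamma a ^ (n + 1))"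
proof (induction n)
  case 0
  show ?case
    using a barnes_G_nonzero[OF a] by (simp add: barnes_G_plus1 Gamma_eq_zero_iff)
next
  case (Suc n)
  have "a + real n + 1 \<notin> \<int>\<^sub>\<le>\<^sub>0"
    using a nonpos_Ints_of_nat_add[of a "Suc n"] by (auto simp: add_ac)
  then have "barnes_G (a + real (Suc n) + 1) = Gamma (a + real (Suc n)) * barnes_G (a + real n + 1)"
    using barnes_G_plus1[of "a + real n + 1"] by (simp add: add_ac)
  moreover have "pochhammer a (Suc n) = Gamma (a + real (Suc n)) / Gamma a"
    using a by (rule pochhammer_Gamma)
  ultimately show ?case
    by (simp add: Suc.IH mult_ac)
qed



section \<open>Alternating binomial sums\<close>

text \<open>Up to the sign \<open>(-1) ^ k\<close>, the \<open>k\<close>-th forward difference of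
  \<open>f\<close> at 0.\<close>

definition alt_binomial_sum :: "nat \<Rightarrow> (nat \<Rightarrow> real) \<Rightarrow> real" where
  "alt_binomial_sum k f = (\<Sum>j\<le>k. (-1) ^ j * real (k choose j) * f j)"

text \<open>Pascal's rule; this recursion drives the inductions below.\<close>

lemma alt_binomial_sum_Suc:
  "alt_binomial_sum (Suc k) f = alt_binomial_sum k f - alt_binomial_sum k (\<lambda>j. f (Suc j))"
proof -
  have "alt_binomial_sum (Suc k) f
      = f 0 + (\<Sum>j\<le>k. (-1) ^ Suc j * real (Suc k choose Suc j) * f (Suc j))"
    unfolding alt_binomial_sum_def by (subst sum.atMost_Suc_shift) simp
  also have "\<dots> = f 0 + (\<Sum>j\<le>k. (-1) ^ Suc j * real (k choose Suc j) * f (Suc j))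
      - (\<Sum>j\<le>k. (-1) ^ j * real (k choose j) * f (Suc j))"
    unfolding sum_subtractf[symmetric] add_diff_eq[symmetric]
    by (intro arg_cong2[where f = "(+)"] refl sum.cong) (simp_all add: algebra_simps)
  also have "f 0 + (\<Sum>j\<le>k. (-1) ^ Suc j * real (k choose Suc j) * f (Suc j))
      = (\<Sum>j\<le>Suc k. (-1) ^ j * real (k choose j) * f j)"
    by (subst sum.atMost_Suc_shift) simp
  also have "\<dots> = (\<Sum>j\<le>k. (-1) ^ j * real (k choose j) * f j)"
    by simp
  finally show ?thesis
    unfolding alt_binomial_sum_def .
qed

text \<open>Shifting the argument keeps degree and leading coefficient, so the latter cancels in the
  difference. The zero polynomial is listed separately because its \<open>degree\<close> is 0, which
  is not below \<open>k\<close> when \<open>k = 0\<close>.\<close>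

lemma degree_diff_shift:
  fixes p :: "real poly"
  assumes "degree p < Suc k"
  shows "p - p \<circ>\<^sub>p [:1, 1:] = 0 \<or> degree (p - p \<circ>\<^sub>p [:1, 1:]) < k"
proof (cases "degree p = 0")
  case True
  then show ?thesis
    by (metis degree_eq_zeroE pcompose_const diff_self)
next
  case False
  have "degree (p \<circ>\<^sub>p [:1, 1:]) = degree p"
    by (simp add: degree_pcompose)
  moreover have "lead_coeff (p \<circ>\<^sub>p [:1, 1:]) = lead_coeff p"
    by (simp add: lead_coeff_comp)
  ultimately have "coeff (p - p \<circ>\<^sub>p [:1, 1:]) (degree p) = 0"
    by simp
  moreover have "degree (p - p \<circ>\<^sub>p [:1, 1:]) \<le> degree p"
    using \<open>degree (p \<circ>\<^sub>p [:1, 1:]) = degree p\<close> by (metis degree_diff_le order_refl)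
  ultimately have "p - p \<circ>\<^sub>p [:1, 1:] = 0 \<or> degree (p - p \<circ>\<^sub>p [:1, 1:]) < degree p"
    by (metis coeff_eq_0 eq_zero_or_degree_less)
  then show ?thesis
    using assms by auto
qed

lemma alt_binomial_sum_poly:
  assumes "degree p < k"
  shows "alt_binomial_sum k (\<lambda>j. poly p (real j)) = 0"
  using assms
proof (induction k arbitrary: p)
  case (Suc k)
  let ?q = "p - p \<circ>\<^sub>p [:1, 1:]"
  have "alt_binomial_sum (Suc k) (\<lambda>j. poly p (real j)) = alt_binomial_sum k (\<lambda>j. poly ?q (real j))"
    unfolding alt_binomial_sum_Suc
    by (simp add: alt_binomial_sum_def poly_pcompose sum_subtractf right_diff_distrib add_ac)
  also have "\<dots> = 0"
  proof (cases "?q = 0")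
    case True
    then have "poly ?q x = 0" for x
      by simp
    then show ?thesis
      by (simp only: alt_binomial_sum_def mult_zero_right sum.neutral_const)
  next
    case False
    then show ?thesis
      using degree_diff_shift[OF Suc.prems] by (intro Suc.IH) auto
  qed
  finally show ?case .
qed simp

text \<open>The partial fraction expansion of \<open>fact k / pochhammer x (Suc k)\<close>. The
  induction ranges over all \<open>x\<close> since the recursion shifts \<open>x\<close> to
  \<open>x + 1\<close>.\<close>

lemma alt_binomial_sum_inverse:
  assumes "x > 0"
  shows "alt_binomial_sum k (\<lambda>j. 1 / (x + real j)) = fact k / pochhammer x (Suc k)"
  using assms
proof (induction k arbitrary: x)
  case 0
  then show ?case by (simp add: alt_binomial_sum_def)
next
  case (Suc k)
  have p: "pochhammer (x + 1) k > 0"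
    using Suc.prems by (intro pochhammer_pos) simp
  have "alt_binomial_sum (Suc k) (\<lambda>j. 1 / (x + real j))
      = fact k / pochhammer x (Suc k) - fact k / pochhammer (x + 1) (Suc k)"
    using Suc.IH[of x] Suc.IH[of "x + 1"] Suc.prems
    unfolding alt_binomial_sum_Suc by (simp add: add_ac)
  also have "pochhammer x (Suc k) = x * pochhammer (x + 1) k"
    by (rule pochhammer_rec)
  also have "pochhammer (x + 1) (Suc k) = pochhammer (x + 1) k * (x + 1 + real k)"
    by (rule pochhammer_Suc)
  also have "fact k / (x * pochhammer (x + 1) k) - fact k / (pochhammer (x + 1) k * (x + 1 + real k))
      = fact (Suc k) / (x * (pochhammer (x + 1) k * (x + 1 + real k)))"
    using p Suc.prems by (simp add: divide_simps) (simp add: algebra_simps)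
  also have "x * (pochhammer (x + 1) k * (x + 1 + real k)) = pochhammer x (Suc (Suc k))"
    by (subst pochhammer_rec, subst pochhammer_Suc) simp
  finally show ?case .
qed

definition pochhammer_poly :: "real \<Rightarrow> nat \<Rightarrow> real poly" where
  "pochhammer_poly x m = (\<Prod>l<m. [:x + real l, 1:])"

lemma poly_pochhammer_poly: "poly (pochhammer_poly x m) y = pochhammer (x + y) m"
  by (simp add: pochhammer_poly_def poly_prod pochhammer_prod atLeast0LessThan add_ac)

lemma degree_pochhammer_poly: "degree (pochhammer_poly x m) = m"
  unfolding pochhammer_poly_def by (subst degree_prod_eq_sum_degree) auto

text \<open>The summand is a polynomial in \<open>j\<close> of degree \<open>l + m\<close>;
  orthogonality will appear in this form.\<close>

lemma alt_binomial_sum_pochhammer: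
  assumes "l + m < k"
  shows "alt_binomial_sum k (\<lambda>j. pochhammer (x + real j) l * pochhammer (y + real j) m) = 0"
proof -
  have "degree (pochhammer_poly x l * pochhammer_poly y m) < k"
    using assms degree_mult_le[of "pochhammer_poly x l" "pochhammer_poly y m"]
    by (simp add: degree_pochhammer_poly)
  from alt_binomial_sum_poly[OF this] show ?thesis
    by (simp add: poly_pochhammer_poly)
qed

text \<open>
  Modulo a polynomial of degree below \<open>k\<close>, the quotient \<open>(a + j)\<^sub>k / (x + j)\<close> is
  \<open>(a - x)\<^sub>k / (x + j)\<close>.
\<close>
lemma alt_binomial_sum_pochhammer_divide:
  assumes "x > 0" "k > 0"
  shows "alt_binomial_sum k (\<lambda>j. pochhammer (a + real j) k / (x + real j))
       = pochhammer (a - x) k * fact k / pochhammer x (Suc k)"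
proof -
  \<comment> \<open>The quotient by the linear polynomial with root \<open>- x\<close>; the
    remainder is the value at that root.\<close>
  define q where "q = synthetic_div (pochhammer_poly a k) (- x)"
  have "pochhammer (a + real j) k = (x + real j) * poly q (real j) + pochhammer (a - x) k" for j
    using arg_cong[OF synthetic_div_correct'[of "- x" "pochhammer_poly a k"], of "\<lambda>p. poly p (real j)"]
    by (simp add: poly_pochhammer_poly q_def algebra_simps)
  then have *: "pochhammer (a + real j) k / (x + real j)
      = poly q (real j) + pochhammer (a - x) k * (1 / (x + real j))" for j
    using assms(1) by (simp add: field_simps)
  have "degree q < k"
    using assms(2) by (simp add: q_def degree_synthetic_div degree_pochhammer_poly)
  then have "alt_binomial_sum k (\<lambda>j. poly q (real j)) = 0"
    by (rule alt_binomial_sum_poly)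
  moreover have "alt_binomial_sum k (\<lambda>j. pochhammer (a + real j) k / (x + real j))
     = alt_binomial_sum k (\<lambda>j. poly q (real j))
       + pochhammer (a - x) k * alt_binomial_sum k (\<lambda>j. 1 / (x + real j))"
    unfolding * by (simp add: alt_binomial_sum_def distrib_left sum.distrib sum_distrib_left mult_ac)
  ultimately show ?thesis
    by (simp add: alt_binomial_sum_inverse[OF assms(1)])
qed

section \<open>Jacobi polynomials and the Hankel matrix\<close>

text \<open>The coefficient of \<open>x^i\<close> in the hypergeometric polynomial 2F1(-k, \<alpha>
  + \<beta> + 1 + k; \<alpha> + 1; x), the Jacobi polynomial on [0, 1] for the weight
  \<open>x^\<alpha> (1 - x)^\<beta>\<close>, scaled to be 1 at 0. It vanishes for
  \<open>i > k\<close>.\<close>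

definition jacobi_coeff :: "real \<Rightarrow> real \<Rightarrow> nat \<Rightarrow> nat \<Rightarrow> real" where
  "jacobi_coeff \<alpha> \<beta> k i = (-1) ^ i * real (k choose i) * pochhammer (\<alpha> + \<beta> + 1 + real k) i
     / pochhammer (\<alpha> + 1) i"

text \<open>
  The case \<open>k = 0\<close> is separate because \<open>k - 1\<close> truncates; the uniform expression, see
  \<open>jacobi_sqnorm_altdef\<close>, is \<open>0/0\<close> when \<open>\<alpha> + \<beta> = -1\<close>.
\<close>
definition jacobi_sqnorm :: "real \<Rightarrow> real \<Rightarrow> nat \<Rightarrow> real" where
  "jacobi_sqnorm \<alpha> \<beta> k = (if k = 0 then 1 else fact k * pochhammer (\<beta> + 1) k
     / (pochhammer (\<alpha> + 1) k * pochhammer (\<alpha> + \<beta> + 2) (k - 1) * (\<alpha> + \<beta> + 1 + 2 * real k)))"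

definition jacobi_coeff_mat :: "real \<Rightarrow> real \<Rightarrow> nat \<Rightarrow> real mat" where
  "jacobi_coeff_mat \<alpha> \<beta> n = mat (n + 1) (n + 1) (\<lambda>(k, i). jacobi_coeff \<alpha> \<beta> k i)"

text \<open>The factor \<open>L^T D^-1\<close>; keeping the norms here makes the factorization below
  an identity matrix.\<close>

definition jacobi_dual_mat :: "real \<Rightarrow> real \<Rightarrow> nat \<Rightarrow> real mat" where
  "jacobi_dual_mat \<alpha> \<beta> n = mat (n + 1) (n + 1) (\<lambda>(i, k). jacobi_coeff \<alpha> \<beta> k i / jacobi_sqnorm \<alpha> \<beta> k)"

lemma jacobi_mats_carrier [simp]:
  "jacobi_coeff_mat \<alpha> \<beta> n \<in> carrier_mat (n + 1) (n + 1)"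
  "jacobi_dual_mat \<alpha> \<beta> n \<in> carrier_mat (n + 1) (n + 1)"
  "jacobi_hankel n \<alpha> \<beta> \<in> carrier_mat (n + 1) (n + 1)"
  by (simp_all add: jacobi_coeff_mat_def jacobi_dual_mat_def jacobi_hankel_def)

text \<open>The product \<open>L^T D^-1 L\<close>, which, unlike the closed formula, does not
  degenerate on the line \<open>\<alpha> + \<beta> = -1\<close>.\<close>

definition jacobi_inverse :: "real \<Rightarrow> real \<Rightarrow> nat \<Rightarrow> real mat" where
  "jacobi_inverse \<alpha> \<beta> n = jacobi_dual_mat \<alpha> \<beta> n * jacobi_coeff_mat \<alpha> \<beta> n"

lemma jacobi_inverse_carrier: "jacobi_inverse \<alpha> \<beta> n \<in> carrier_mat (n + 1) (n + 1)"
  unfolding jacobi_inverse_def by (rule mult_carrier_mat) (rule jacobi_mats_carrier)+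

lemma jacobi_inverse_index:
  assumes "i \<le> n" "j \<le> n"
  shows "jacobi_inverse \<alpha> \<beta> n $$ (i, j)
    = (\<Sum>k\<le>n. jacobi_coeff \<alpha> \<beta> k i * jacobi_coeff \<alpha> \<beta> k j / jacobi_sqnorm \<alpha> \<beta> k)"
  using assms by (simp add: jacobi_inverse_def jacobi_coeff_mat_def jacobi_dual_mat_def scalar_prod_def
      atLeast0LessThan lessThan_Suc_atMost del: sum.lessThan_Suc sum.atMost_Suc)

section \<open>Orthogonality of the Jacobi polynomials; determinant and inverse of the Hankel
  matrix\<close>

context
  fixes \<alpha> \<beta> :: real
  assumes \<alpha>: "\<alpha> > -1" and \<beta>: "\<beta> > -1"
begin

section \<open>Alternating binomial sums\<close>

lemma jacobi_coeff_diag_nonzero: "jacobi_coeff \<alpha> \<beta> k k \<noteq> 0"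
\<comment> \<open>For \<open>k = 0\<close> the base \<open>\<alpha> + \<beta> + 1\<close> need not
  be positive; for \<open>k > 0\<close> the base is positive since
  \<open>\<alpha> + \<beta> > -2\<close>.\<close>
proof (cases "k = 0")
  case False
  then have "pochhammer (\<alpha> + \<beta> + 1 + real k) k > 0" "pochhammer (\<alpha> + 1) k > 0"
    using \<alpha> \<beta> by (auto intro!: pochhammer_pos)
  then show ?thesis
    by (simp add: jacobi_coeff_def)
qed (simp add: jacobi_coeff_def)

lemma jacobi_sqnorm_pos: "jacobi_sqnorm \<alpha> \<beta> k > 0"
  using \<alpha> \<beta> by (auto simp: jacobi_sqnorm_def intro!: divide_pos_pos mult_pos_pos pochhammer_pos)

text \<open>Dividing \<open>(\<alpha> + 1)_(i+j)\<close> by \<open>(\<alpha> + 1)_j\<close> leaves a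
  polynomial in \<open>j\<close>, so the integral of \<open>x^i p_k\<close> becomes an alternating
  binomial sum.\<close>

lemma jacobi_coeff_moment:
  assumes "k > 0"
  shows "(\<Sum>j\<le>k. jacobi_coeff \<alpha> \<beta> k j * (pochhammer (\<alpha> + 1) (i + j) / pochhammer (\<alpha> + \<beta> + 2) (i + j)))
    = alt_binomial_sum k (\<lambda>j. pochhammer (\<alpha> + 1 + real j) i *
        (pochhammer (\<alpha> + \<beta> + 1 + real k) j / pochhammer (\<alpha> + \<beta> + 2) (i + j)))"
  unfolding alt_binomial_sum_def
proof (rule sum.cong)
  fix j
  have "pochhammer (\<alpha> + 1) j > 0"
    using \<alpha> by (intro pochhammer_pos) simp
  moreover have "pochhammer (\<alpha> + 1) (i + j) = pochhammer (\<alpha> + 1) j * pochhammer (\<alpha> + 1 + real j) i"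
    by (metis pochhammer_product' add.commute)
  ultimately show "jacobi_coeff \<alpha> \<beta> k j * (pochhammer (\<alpha> + 1) (i + j) / pochhammer (\<alpha> + \<beta> + 2) (i + j))
     = (-1) ^ j * real (k choose j) * (pochhammer (\<alpha> + 1 + real j) i *
        (pochhammer (\<alpha> + \<beta> + 1 + real k) j / pochhammer (\<alpha> + \<beta> + 2) (i + j)))"
    by (simp add: jacobi_coeff_def)
qed simp

text \<open>Brings the symbol to the base \<open>\<alpha> + \<beta> + 2\<close> of the moment
  denominators, so that the two can cancel.\<close>

lemma pochhammer_shift_quotient:
  assumes "k > 0"
  shows "pochhammer (\<alpha> + \<beta> + 1 + real k) j
       = pochhammer (\<alpha> + \<beta> + 2) (k - 1 + j) / pochhammer (\<alpha> + \<beta> + 2) (k - 1)"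
proof -
  have "pochhammer (\<alpha> + \<beta> + 2) (k - 1) > 0"
    using \<alpha> \<beta> by (intro pochhammer_pos) simp
  moreover have "\<alpha> + \<beta> + 2 + real (k - 1) = \<alpha> + \<beta> + 1 + real k"
    using assms by (simp add: of_nat_diff)
  ultimately show ?thesis
    by (simp only: pochhammer_product') simp
qed

text \<open>For \<open>i < k\<close> the denominator cancels completely, leaving a polynomial in
  \<open>j\<close> of degree \<open>i + (k - 1 - i) = k - 1\<close>.\<close>

lemma jacobi_orthogonal_less:
  assumes "i < k"
  shows "(\<Sum>j\<le>k. jacobi_coeff \<alpha> \<beta> k j * (pochhammer (\<alpha> + 1) (i + j) / pochhammer (\<alpha> + \<beta> + 2) (i + j))) = 0"
proof -
  let ?C = "pochhammer (\<alpha> + \<beta> + 2) (k - 1)"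
  have k: "k > 0" using assms by simp
  have "pochhammer (\<alpha> + \<beta> + 1 + real k) j / pochhammer (\<alpha> + \<beta> + 2) (i + j)
      = pochhammer (\<alpha> + \<beta> + 2 + real i + real j) (k - 1 - i) / ?C" for j
  proof -
    have "pochhammer (\<alpha> + \<beta> + 2) (i + j) > 0"
      using \<alpha> \<beta> by (intro pochhammer_pos) simp
    moreover have "pochhammer (\<alpha> + \<beta> + 2) (k - 1 + j) =
      pochhammer (\<alpha> + \<beta> + 2) (i + j) * pochhammer (\<alpha> + \<beta> + 2 + real i + real j) (k - 1 - i)"
      using pochhammer_product[of "i + j" "k - 1 + j" "\<alpha> + \<beta> + 2"] assms by (simp add: add_ac)
    ultimately show ?thesis
      by (simp add: pochhammer_shift_quotient[OF k])
  qed
  then have "alt_binomial_sum k (\<lambda>j. pochhammer (\<alpha> + 1 + real j) i *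
        (pochhammer (\<alpha> + \<beta> + 1 + real k) j / pochhammer (\<alpha> + \<beta> + 2) (i + j)))
     = alt_binomial_sum k (\<lambda>j. pochhammer (\<alpha> + 1 + real j) i * pochhammer (\<alpha> + \<beta> + 2 + real i + real j) (k - 1 - i)) / ?C"
    by (simp add: alt_binomial_sum_def sum_divide_distrib)
  also have "\<dots> = 0"
    using assms by (subst alt_binomial_sum_pochhammer) auto
  finally show ?thesis
    unfolding jacobi_coeff_moment[OF k] .
qed

text \<open>For \<open>i = k\<close> exactly one linear factor stays in the denominator, and the sum
  is given by \<open>alt_binomial_sum_pochhammer_divide\<close>. Since \<open>p_k\<close> is
  orthogonal to lower powers, only its leading term enters the norm.\<close>

lemma jacobi_orthogonal_eq:
  "jacobi_coeff \<alpha> \<beta> k k *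
     (\<Sum>j\<le>k. jacobi_coeff \<alpha> \<beta> k j * (pochhammer (\<alpha> + 1) (k + j) / pochhammer (\<alpha> + \<beta> + 2) (k + j)))
   = jacobi_sqnorm \<alpha> \<beta> k"
proof (cases "k = 0")
  case True
  then show ?thesis by (simp add: jacobi_coeff_def jacobi_sqnorm_def)
next
  case False
  then have k: "k > 0" by simp
  let ?C = "pochhammer (\<alpha> + \<beta> + 2) (k - 1)"
  let ?x = "\<alpha> + \<beta> + 1 + real k"
  have x: "?x > 0" using k \<alpha> \<beta> by simp
  have "pochhammer ?x j / pochhammer (\<alpha> + \<beta> + 2) (k + j) = 1 / (?C * (?x + real j))" for j
  proof -
    have "pochhammer (\<alpha> + \<beta> + 2) (k - 1 + j) > 0"
      using \<alpha> \<beta> by (intro pochhammer_pos) simp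
    moreover have "pochhammer (\<alpha> + \<beta> + 2) (k + j) = pochhammer (\<alpha> + \<beta> + 2) (k - 1 + j) * (?x + real j)"
      using k pochhammer_Suc[of "\<alpha> + \<beta> + 2" "k - 1 + j"] by (simp add: of_nat_diff add_ac)
    ultimately show ?thesis
      by (simp add: pochhammer_shift_quotient[OF k])
  qed
  then have "(\<Sum>j\<le>k. jacobi_coeff \<alpha> \<beta> k j * (pochhammer (\<alpha> + 1) (k + j) / pochhammer (\<alpha> + \<beta> + 2) (k + j)))
      = alt_binomial_sum k (\<lambda>j. pochhammer (\<alpha> + 1 + real j) k / (?x + real j)) / ?C"
    unfolding jacobi_coeff_moment[OF k] by (simp add: alt_binomial_sum_def sum_divide_distrib mult_ac)
  also have "\<dots> = pochhammer (\<alpha> + 1 - ?x) k * fact k / (pochhammer ?x (Suc k) * ?C)"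
    by (simp add: alt_binomial_sum_pochhammer_divide[OF x k])
  \<comment> \<open>Reflection: \<open>\<alpha> + 1 - ?x\<close> equals
    \<open>- (\<beta> + k)\<close>. The sign cancels later against that of the leading
    coefficient.\<close>
  also have "pochhammer (\<alpha> + 1 - ?x) k = (-1) ^ k * pochhammer (\<beta> + 1) k"
    using pochhammer_minus[of "\<beta> + real k" k] by (simp add: algebra_simps)
  also have "pochhammer ?x (Suc k) = pochhammer ?x k * (\<alpha> + \<beta> + 1 + 2 * real k)"
    by (simp add: pochhammer_Suc)
  finally have *: "(\<Sum>j\<le>k. jacobi_coeff \<alpha> \<beta> k j * (pochhammer (\<alpha> + 1) (k + j) / pochhammer (\<alpha> + \<beta> + 2) (k + j)))
     = (-1) ^ k * pochhammer (\<beta> + 1) k * fact k / (pochhammer ?x k * (\<alpha> + \<beta> + 1 + 2 * real k) * ?C)" .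
  have "pochhammer ?x k > 0"
    by (intro pochhammer_pos x)
  moreover have "(-1) ^ k * ((-1) ^ k * y) = y" for y :: real
    by (simp add: mult.assoc[symmetric] power_mult_distrib[symmetric])
  ultimately show ?thesis
    unfolding * using k by (simp add: jacobi_coeff_def jacobi_sqnorm_def mult_ac)
qed


text \<open>If \<open>l < k\<close>, every term vanishes: for \<open>i < k\<close> by orthogonality,
  for \<open>i \<ge> k\<close> because \<open>p_l\<close> has no such coefficient. Symmetry settles
  the other order.\<close>

lemma jacobi_biorthogonal:
  assumes "k \<le> n" "l \<le> n"
  shows "(\<Sum>i\<le>n. (\<Sum>j\<le>n. jacobi_coeff \<alpha> \<beta> k j *
      (pochhammer (\<alpha> + 1) (i + j) / pochhammer (\<alpha> + \<beta> + 2) (i + j))) * jacobi_coeff \<alpha> \<beta> l i)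
    = (if k = l then jacobi_sqnorm \<alpha> \<beta> k else 0)"
    (is "?B k l = _")
proof -
  let ?m = "\<lambda>i. pochhammer (\<alpha> + 1) i / pochhammer (\<alpha> + \<beta> + 2) i"
  have row: "(\<Sum>j\<le>n. jacobi_coeff \<alpha> \<beta> k j * ?m (i + j)) = (\<Sum>j\<le>k. jacobi_coeff \<alpha> \<beta> k j * ?m (i + j))"
    if "k \<le> n" for k i
    using that by (intro sum.mono_neutral_right) (auto simp: jacobi_coeff_def not_le)
  have less: "?B k l = 0" if "k \<le> n" "l < k" for k l
  proof (intro sum.neutral ballI)
    fix i
    show "(\<Sum>j\<le>n. jacobi_coeff \<alpha> \<beta> k j * ?m (i + j)) * jacobi_coeff \<alpha> \<beta> l i = 0"
    proof (cases "i < k")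
      case True
      then show ?thesis
        by (simp only: row[OF that(1)] jacobi_orthogonal_less mult_zero_left)
    next
      case False
      then show ?thesis
        using that by (simp add: jacobi_coeff_def)
    qed
  qed
  have eq: "?B k k = jacobi_sqnorm \<alpha> \<beta> k" if "k \<le> n" for k
  proof -
    have "?B k k = (\<Sum>i\<in>{k}. (\<Sum>j\<le>n. jacobi_coeff \<alpha> \<beta> k j * ?m (i + j)) * jacobi_coeff \<alpha> \<beta> k i)"
    proof (rule sum.mono_neutral_right)
      show "\<forall>i\<in>{..n} - {k}. (\<Sum>j\<le>n. jacobi_coeff \<alpha> \<beta> k j * ?m (i + j)) * jacobi_coeff \<alpha> \<beta> k i = 0"
      proof
        fix i assume "i \<in> {..n} - {k}"
        then consider "i < k" | "k < i" by fastforce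
        then show "(\<Sum>j\<le>n. jacobi_coeff \<alpha> \<beta> k j * ?m (i + j)) * jacobi_coeff \<alpha> \<beta> k i = 0"
        proof cases
          case 1
          then show ?thesis
            by (simp only: row[OF that] jacobi_orthogonal_less mult_zero_left)
        qed (simp add: jacobi_coeff_def)
      qed
    qed (use that in auto)
    also have "\<dots> = jacobi_sqnorm \<alpha> \<beta> k"
      using jacobi_orthogonal_eq[of k] by (simp only: row[OF that] mult.commute) simp
    finally show ?thesis .
  qed
  \<comment> \<open>The moments depend on \<open>i + j\<close> only, so the bilinear form is
    symmetric.\<close>
  have sym: "?B k l = ?B l k"
    unfolding sum_distrib_right by (subst sum.swap) (simp add: mult_ac add.commute)
  consider "k = l" | "l < k" | "k < l" by linarith
  then show ?thesis
  proof cases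
    case 3
    then show ?thesis
      using less[of l k] assms by (simp only: sym) simp
  qed (use less eq assms in auto)
qed

lemma jacobi_hankel_factorization:
  "jacobi_coeff_mat \<alpha> \<beta> n * jacobi_hankel n \<alpha> \<beta> * jacobi_dual_mat \<alpha> \<beta> n = 1\<^sub>m (n + 1)"
proof (rule eq_matI)
  fix k l
  assume "k < dim_row (1\<^sub>m (n + 1) :: real mat)" "l < dim_col (1\<^sub>m (n + 1) :: real mat)"
  then have kl: "k \<le> n" "l \<le> n" by auto
  have "(jacobi_coeff_mat \<alpha> \<beta> n * jacobi_hankel n \<alpha> \<beta> * jacobi_dual_mat \<alpha> \<beta> n) $$ (k, l)
     = (\<Sum>i\<le>n. (\<Sum>j\<le>n. jacobi_coeff \<alpha> \<beta> k j *
          (pochhammer (\<alpha> + 1) (i + j) / pochhammer (\<alpha> + \<beta> + 2) (i + j)))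
        * (jacobi_coeff \<alpha> \<beta> l i / jacobi_sqnorm \<alpha> \<beta> l))"
    using kl by (simp add: jacobi_coeff_mat_def jacobi_dual_mat_def jacobi_hankel_def scalar_prod_def
        atLeast0LessThan lessThan_Suc_atMost add.commute del: sum.lessThan_Suc sum.atMost_Suc)
  also have "\<dots> = (if k = l then 1 else 0)"
    using jacobi_biorthogonal[OF kl] jacobi_sqnorm_pos[of l]
    by (simp add: sum_divide_distrib[symmetric])
  finally show "(jacobi_coeff_mat \<alpha> \<beta> n * jacobi_hankel n \<alpha> \<beta> * jacobi_dual_mat \<alpha> \<beta> n) $$ (k, l)
      = 1\<^sub>m (n + 1) $$ (k, l)"
    using kl by simp
qed (simp_all add: jacobi_coeff_mat_def jacobi_dual_mat_def)

text \<open>The two outer factors of the factorization are triangular, so their determinants are the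
  products of their diagonals.\<close>

lemma det_jacobi_hankel:
  "Determinant.det (jacobi_hankel n \<alpha> \<beta>)
     = (\<Prod>k\<le>n. jacobi_sqnorm \<alpha> \<beta> k / (jacobi_coeff \<alpha> \<beta> k k)\<^sup>2)"
proof -
  have L: "Determinant.det (jacobi_coeff_mat \<alpha> \<beta> n) = (\<Prod>k\<le>n. jacobi_coeff \<alpha> \<beta> k k)"
    by (subst det_lower_triangular[OF _ jacobi_mats_carrier(1)])
      (auto simp: jacobi_coeff_mat_def jacobi_coeff_def prod_list_diag_prod
        atLeast0LessThan lessThan_Suc_atMost simp del: prod.lessThan_Suc prod.atMost_Suc)
  have W: "Determinant.det (jacobi_dual_mat \<alpha> \<beta> n) = (\<Prod>k\<le>n. jacobi_coeff \<alpha> \<beta> k k / jacobi_sqnorm \<alpha> \<beta> k)"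
    by (subst det_upper_triangular[OF _ jacobi_mats_carrier(2)])
      (auto simp: jacobi_dual_mat_def jacobi_coeff_def prod_list_diag_prod
        atLeast0LessThan lessThan_Suc_atMost simp del: prod.lessThan_Suc prod.atMost_Suc)
  have "Determinant.det (jacobi_coeff_mat \<alpha> \<beta> n) * Determinant.det (jacobi_hankel n \<alpha> \<beta>)
      * Determinant.det (jacobi_dual_mat \<alpha> \<beta> n) = 1"
    using arg_cong[OF jacobi_hankel_factorization[of n], of Determinant.det]
    by (simp add: det_mult[of _ "n + 1"] mult_carrier_mat[of _ "n + 1" "n + 1"] det_one
        del: One_nat_def add_Suc_right)
  moreover have "(\<Prod>k\<le>n. jacobi_coeff \<alpha> \<beta> k k) * (\<Prod>k\<le>n. jacobi_sqnorm \<alpha> \<beta> k / (jacobi_coeff \<alpha> \<beta> k k)\<^sup>2)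
      * (\<Prod>k\<le>n. jacobi_coeff \<alpha> \<beta> k k / jacobi_sqnorm \<alpha> \<beta> k) = 1"
    unfolding prod.distrib[symmetric]
    using jacobi_coeff_diag_nonzero jacobi_sqnorm_pos
    by (intro prod.neutral) (auto simp: power2_eq_square less_imp_neq[symmetric])
  ultimately show ?thesis
    unfolding L W using jacobi_coeff_diag_nonzero jacobi_sqnorm_pos
    by (smt (verit) mult_cancel_left mult_cancel_right mult_eq_0_iff)
qed

lemma jacobi_inverse_inverts:
  "jacobi_hankel n \<alpha> \<beta> * jacobi_inverse \<alpha> \<beta> n = 1\<^sub>m (n + 1)"
  "jacobi_inverse \<alpha> \<beta> n * jacobi_hankel n \<alpha> \<beta> = 1\<^sub>m (n + 1)"
proof -
  note carr = jacobi_mats_carrier(1,2)[of \<alpha> \<beta> n] jacobi_mats_carrier(3)[of n \<alpha> \<beta>]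
  have "jacobi_coeff_mat \<alpha> \<beta> n * (jacobi_hankel n \<alpha> \<beta> * jacobi_dual_mat \<alpha> \<beta> n) = 1\<^sub>m (n + 1)"
    using jacobi_hankel_factorization assoc_mult_mat[OF carr(1) carr(3) carr(2)] by simp
  \<comment> \<open>A one-sided inverse of a square matrix is two-sided, which allows the left
    factor to be moved to the right end.\<close>
  then have "(jacobi_hankel n \<alpha> \<beta> * jacobi_dual_mat \<alpha> \<beta> n) * jacobi_coeff_mat \<alpha> \<beta> n = 1\<^sub>m (n + 1)"
    by (rule mat_mult_left_right_inverse[OF carr(1) mult_carrier_mat[OF carr(3) carr(2)]])
  then show 1: "jacobi_hankel n \<alpha> \<beta> * jacobi_inverse \<alpha> \<beta> n = 1\<^sub>m (n + 1)"
    unfolding jacobi_inverse_def using assoc_mult_mat[OF carr(3) carr(2) carr(1)] by simp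
  show "jacobi_inverse \<alpha> \<beta> n * jacobi_hankel n \<alpha> \<beta> = 1\<^sub>m (n + 1)"
    by (rule mat_mult_left_right_inverse[OF carr(3) jacobi_inverse_carrier 1])
qed

end


lemma not_nonpos_Int_if_gt_minus_1: "(s :: real) > -1 \<Longrightarrow> s \<noteq> 0 \<Longrightarrow> s \<notin> \<int>\<^sub>\<le>\<^sub>0"
  by (auto elim!: nonpos_Ints_cases)

lemma pochhammer_nonzero: "(s :: real) \<notin> \<int>\<^sub>\<le>\<^sub>0 \<Longrightarrow> pochhammer s k \<noteq> 0"
  by (auto dest: pochhammer_eq_0_imp_nonpos_Int)

section \<open>Closed forms off the line where \<alpha> + \<beta> = -1\<close>

lemma jacobi_sqnorm_altdef:
  assumes "\<alpha> + \<beta> \<noteq> -1"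
  shows "jacobi_sqnorm \<alpha> \<beta> k = fact k * pochhammer (\<beta> + 1) k * (\<alpha> + \<beta> + 1)
    / (pochhammer (\<alpha> + 1) k * pochhammer (\<alpha> + \<beta> + 1) k * (\<alpha> + \<beta> + 1 + 2 * real k))"
proof (cases k)
  case 0
  then show ?thesis
    using assms by (simp add: jacobi_sqnorm_def)
next
  case (Suc l)
  have "pochhammer (\<alpha> + \<beta> + 1) k = (\<alpha> + \<beta> + 1) * pochhammer (\<alpha> + \<beta> + 2) (k - 1)"
    unfolding Suc pochhammer_rec by (simp add: add_ac)
  moreover have "\<alpha> + \<beta> + 1 \<noteq> 0"
    using assms by linarith
  ultimately show ?thesis
    using Suc by (simp add: jacobi_sqnorm_def)
qed

lemma jacobi_inverse_eq_formula:
  assumes \<alpha>: "\<alpha> > -1" and \<beta>: "\<beta> > -1" and s: "\<alpha> + \<beta> \<noteq> -1" and ij: "i \<le> n" "j \<le> n"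
  shows "jacobi_inverse \<alpha> \<beta> n $$ (i, j) = jacobi_inverse_formula n i j \<alpha> \<beta>"
proof -
  define s where "s = \<alpha> + \<beta> + 1"
  have s0: "s \<noteq> 0"
    using s by (simp add: s_def)
  \<comment> \<open>\<open>s\<close> may lie between -1 and 0; only the first factor
    \<open>s\<close> can be negative, and the others are positive.\<close>
  have ps: "pochhammer s k \<noteq> 0" for k
    using \<alpha> \<beta> s0
    by (cases k) (auto simp: pochhammer_rec s_def intro!: less_imp_neq[symmetric] pochhammer_pos)
  \<comment> \<open>Both sides are \<open>(s)_(i+k)\<close>; this exchanges the
    \<open>(s + k)_i\<close> of the coefficients for the \<open>(s + i)_k\<close> of the
    formula.\<close>
  have shift: "pochhammer s i * pochhammer (s + real i) k = pochhammer s k * pochhammer (s + real k) i" for i k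
    by (metis pochhammer_product' add.commute)
  have sqnorm: "jacobi_sqnorm \<alpha> \<beta> k = fact k * pochhammer (\<beta> + 1) k * s
      / (pochhammer (\<alpha> + 1) k * pochhammer s k * (s + 2 * real k))" for k
    using s by (simp add: jacobi_sqnorm_altdef s_def)
  have coeff: "jacobi_coeff \<alpha> \<beta> k i = (-1) ^ i * real (k choose i) * pochhammer (s + real k) i
      / pochhammer (\<alpha> + 1) i" for k i
    by (simp add: jacobi_coeff_def s_def)
  let ?t = "\<lambda>k. jacobi_coeff \<alpha> \<beta> k i * jacobi_coeff \<alpha> \<beta> k j / jacobi_sqnorm \<alpha> \<beta> k"
  have t: "?t k = (-1) ^ (i + j) * pochhammer s i * pochhammer s j
       / (pochhammer (\<alpha> + 1) i * pochhammer (\<alpha> + 1) j * s) * (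
          (s + 2 * real k) * pochhammer (\<alpha> + 1) k
            / (fact k * pochhammer s k * pochhammer (\<beta> + 1) k)
          * real (k choose i) * real (k choose j)
          * pochhammer (s + real i) k * pochhammer (s + real j) k)" for k
  proof -
    have "?t k = (-1) ^ (i + j) * real (k choose i) * real (k choose j)
       * pochhammer (s + real k) i * pochhammer (s + real k) j
       * (s + 2 * real k) * pochhammer (\<alpha> + 1) k * pochhammer s k
       / (pochhammer (\<alpha> + 1) i * pochhammer (\<alpha> + 1) j * s * fact k * pochhammer (\<beta> + 1) k)"
      unfolding sqnorm coeff by (simp add: power_add mult_ac)
    \<comment> \<open>Expanding the fraction by \<open>(s)_k\<close> provides one copy for each of
      the two coefficients.\<close>
    also have "\<dots> = (-1) ^ (i + j) * real (k choose i) * real (k choose j)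
       * (pochhammer s k * pochhammer (s + real k) i) * (pochhammer s k * pochhammer (s + real k) j)
       * (s + 2 * real k) * pochhammer (\<alpha> + 1) k
       / (pochhammer (\<alpha> + 1) i * pochhammer (\<alpha> + 1) j * s * fact k * pochhammer s k * pochhammer (\<beta> + 1) k)"
      using ps[of k] by (simp add: mult_ac)
    finally show ?thesis
      unfolding shift[symmetric] by (simp add: mult_ac)
  qed
  have "jacobi_inverse \<alpha> \<beta> n $$ (i, j) = (\<Sum>k\<le>n. ?t k)"
    by (rule jacobi_inverse_index[OF ij])
  also have "\<dots> = (\<Sum>k = max i j..n. ?t k)"
    by (intro sum.mono_neutral_right) (auto simp: jacobi_coeff_def max_def not_le split: if_splits)
  also have "\<dots> = jacobi_inverse_formula n i j \<alpha> \<beta>"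
    unfolding t sum_distrib_left[symmetric] jacobi_inverse_formula_def
    by (simp add: s_def add_ac)
  finally show ?thesis .
qed

section \<open>The determinant in terms of the Barnes function\<close>

lemma Gamma_legendre_duplication_real:
  fixes z :: real
  assumes "z \<notin> \<int>\<^sub>\<le>\<^sub>0" "z + 1/2 \<notin> \<int>\<^sub>\<le>\<^sub>0"
  shows "Gamma z * Gamma (z + 1/2) = 2 powr (1 - 2 * z) * sqrt pi * Gamma (2 * z)"
proof -
  have "complex_of_real z \<notin> \<int>\<^sub>\<le>\<^sub>0" "complex_of_real z + 1/2 \<notin> \<int>\<^sub>\<le>\<^sub>0"
    using assms of_real_in_nonpos_Ints_iff[of "z + 1/2", where 'a = complex]
    by (simp_all add: of_real_in_nonpos_Ints_iff)
  from Gamma_legendre_duplication[OF this]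
  have "complex_of_real (Gamma z * Gamma (z + 1/2))
      = complex_of_real (exp ((1 - 2 * z) * ln 2) * sqrt pi * Gamma (2 * z))"
    by (simp add: Gamma_complex_of_real[symmetric] exp_of_real[symmetric])
  then show ?thesis
    unfolding of_real_eq_iff by (simp add: powr_def)
qed

text \<open>The exponents of 2 add up to \<open>4 (0 + ... + n) = 2 n (n + 1)\<close>, written as an
  \<open>(n + 1)\<close>-st power to match the determinant formula.\<close>

lemma prod_power_16: "(\<Prod>k\<le>n. 16 ^ k :: real) = (2 ^ (2 * n)) ^ (n + 1)"
proof (induction n)
  case (Suc n)
  have "(\<Prod>k\<le>Suc n. 16 ^ k :: real) = (2 ^ (2 * n)) ^ (n + 1) * (2 ^ 4) ^ Suc n"
    unfolding prod.atMost_Suc Suc.IH by simp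
  also have "\<dots> = 2 ^ (2 * n * (n + 1) + 4 * Suc n)"
    by (simp only: power_mult power_add)
  also have "2 * n * (n + 1) + 4 * Suc n = 2 * Suc n * (Suc n + 1)"
    by simp
  finally show ?case
    by (simp only: power_mult)
qed simp

text \<open>By duplication \<open>(s)_k (s + k)_k = (s)_(2k) = 4^k (s/2)_k ((s + 1)/2)_k\<close>.
  Writing \<open>fact k\<close> as \<open>pochhammer 1 k\<close> makes
  \<open>prod_pochhammer_barnes_G\<close> applicable to it too.\<close>

lemma jacobi_pivot:
  assumes \<alpha>: "\<alpha> > -1" and \<beta>: "\<beta> > -1" and s: "s = \<alpha> + \<beta> + 1" "s \<noteq> 0"
  shows "jacobi_sqnorm \<alpha> \<beta> k / (jacobi_coeff \<alpha> \<beta> k k)\<^sup>2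
    = pochhammer 1 k * pochhammer (\<alpha> + 1) k * pochhammer (\<beta> + 1) k * pochhammer s k * (s / 2)
      / (16 ^ k * (s / 2 + real k) * (pochhammer (s / 2) k)\<^sup>2 * (pochhammer ((s + 1) / 2) k)\<^sup>2)"
proof -
  have ps: "pochhammer s k \<noteq> 0"
    using \<alpha> \<beta> s by (intro pochhammer_nonzero not_nonpos_Int_if_gt_minus_1) auto
  have pa: "pochhammer (\<alpha> + 1) k > 0"
    using \<alpha> by (intro pochhammer_pos) simp
  have "pochhammer s k * pochhammer (s + real k) k = pochhammer s (2 * k)"
    by (simp add: mult_2 pochhammer_product')
  also have "\<dots> = 4 ^ k * pochhammer (s / 2) k * pochhammer ((s + 1) / 2) k"
    using pochhammer_double[of "s / 2" k] by (simp add: power_mult add_divide_distrib)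
  finally have "pochhammer (s + real k) k = 4 ^ k * pochhammer (s / 2) k * pochhammer ((s + 1) / 2) k / pochhammer s k"
    using ps by (simp add: field_simps)
  then have "(jacobi_coeff \<alpha> \<beta> k k)\<^sup>2 = 16 ^ k * (pochhammer (s / 2) k)\<^sup>2 * (pochhammer ((s + 1) / 2) k)\<^sup>2
      / ((pochhammer s k)\<^sup>2 * (pochhammer (\<alpha> + 1) k)\<^sup>2)"
    by (simp add: jacobi_coeff_def s(1)[symmetric] power_divide power_mult_distrib
        power_mult[symmetric] mult.commute[of k] power_mult[of _ 2])
  \<comment> \<open>Halving turns \<open>s + 2 k\<close> into \<open>s/2 + k\<close>, whose product
    over \<open>k \<le> n\<close> is \<open>(s/2)_(n+1)\<close>.\<close>
  moreover have half: "A * s / (B * (s + 2 * real k)) = A * (s / 2) / (B * (s / 2 + real k))" for A B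
    using mult_divide_mult_cancel_left[of 2 "A * (s / 2)" "B * (s / 2 + real k)"] by (simp add: algebra_simps)
  have "jacobi_sqnorm \<alpha> \<beta> k = pochhammer 1 k * pochhammer (\<beta> + 1) k * (s / 2)
      / (pochhammer (\<alpha> + 1) k * pochhammer s k * (s / 2 + real k))"
    using s jacobi_sqnorm_altdef[of \<alpha> \<beta> k] unfolding half[symmetric] by (simp add: pochhammer_fact)
  ultimately show ?thesis
    using ps pa by (simp add: power2_eq_square mult_ac)
qed

lemma det_jacobi_hankel_eq_formula:
  assumes \<alpha>: "\<alpha> > -1" and \<beta>: "\<beta> > -1" and s: "\<alpha> + \<beta> \<noteq> -1"
  shows "Determinant.det (jacobi_hankel n \<alpha> \<beta>) = jacobi_det_formula n \<alpha> \<beta>"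
proof -
  define s where "s = \<alpha> + \<beta> + 1"
  have s0: "s \<noteq> 0" "s > -1"
    using s \<alpha> \<beta> by (auto simp: s_def)
  let ?a = "\<alpha> + 1" and ?b = "\<beta> + 1" and ?u = "s / 2" and ?v = "(s + 1) / 2"
  have nonpos: "?a \<notin> \<int>\<^sub>\<le>\<^sub>0" "?b \<notin> \<int>\<^sub>\<le>\<^sub>0" "s \<notin> \<int>\<^sub>\<le>\<^sub>0" "?u \<notin> \<int>\<^sub>\<le>\<^sub>0" "?v \<notin> \<int>\<^sub>\<le>\<^sub>0"
    using s0 \<alpha> \<beta> by (simp_all add: not_nonpos_Int_if_gt_minus_1)
  define N where "N = n + 1"
  let ?G = "barnes_G :: real \<Rightarrow> real"
  have prods: "(\<Prod>k\<le>n. pochhammer 1 k) = ?G (real n + 2)"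
    "(\<Prod>k\<le>n. pochhammer ?a k) = ?G (\<alpha> + real n + 2) / (?G ?a * Gamma ?a ^ N)"
    "(\<Prod>k\<le>n. pochhammer ?b k) = ?G (\<beta> + real n + 2) / (?G ?b * Gamma ?b ^ N)"
    "(\<Prod>k\<le>n. pochhammer s k) = ?G (s + real n + 1) / (?G s * Gamma s ^ N)"
    "(\<Prod>k\<le>n. pochhammer ?u k) = ?G (?u + real n + 1) / (?G ?u * Gamma ?u ^ N)"
    "(\<Prod>k\<le>n. pochhammer ?v k) = ?G (?v + real n + 1) / (?G ?v * Gamma ?v ^ N)"
    using prod_pochhammer_barnes_G[of 1 n] prod_pochhammer_barnes_G[OF nonpos(1), of n]
      prod_pochhammer_barnes_G[OF nonpos(2), of n] prod_pochhammer_barnes_G[OF nonpos(3), of n]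
      prod_pochhammer_barnes_G[OF nonpos(4), of n] prod_pochhammer_barnes_G[OF nonpos(5), of n]
    by (simp_all add: barnes_G_1 N_def add_ac)
  have lin: "(\<Prod>k\<le>n. ?u + real k) = pochhammer ?u N"
    by (simp add: N_def pochhammer_prod atLeast0LessThan lessThan_Suc_atMost)
  \<comment> \<open>The base of the \<open>N\<close>-th power: the left side is the one in the
    formula, the right side collects the Gamma factors from \<open>prods\<close>. Legendre
    duplication at \<open>s / 2\<close> identifies them.\<close>
  have gamma: "pi * Gamma (s + 1) / (2 powr (2 * real n + 2 * s - 1) * Gamma ?a * Gamma ?b)
      = ?u * (Gamma ?u * Gamma ?v)\<^sup>2 / (2 ^ (2 * n) * Gamma ?a * Gamma ?b * Gamma s)"
  proof -
    define q :: real where "q = (2 powr (1 - s))\<^sup>2"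
    have q: "q > 0"
      by (simp add: q_def)
    have "Gamma ?u * Gamma ?v = 2 powr (1 - s) * sqrt pi * Gamma s"
      using Gamma_legendre_duplication_real[of ?u] nonpos by (simp add: add_divide_distrib)
    then have 1: "(Gamma ?u * Gamma ?v)\<^sup>2 = q * (pi * (Gamma s)\<^sup>2)"
      by (simp add: power_mult_distrib q_def)
    have 2: "Gamma (s + 1) = s * Gamma s"
      using nonpos by (intro Gamma_plus1) auto
    have 3: "2 powr (2 * real n + 2 * s - 1) = 2 * 2 ^ (2 * n) / q"
    proof -
      have "q = (2 :: real) powr (2 - 2 * s)"
        by (simp add: q_def power2_eq_square powr_add[symmetric])
      moreover have "2 * 2 ^ (2 * n) = (2 :: real) powr (1 + 2 * real n)"
        by (simp add: powr_add powr_realpow[symmetric])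
      ultimately show ?thesis
        by (simp add: powr_diff[symmetric])
    qed
    have "Gamma s \<noteq> 0"
      using nonpos by (simp add: Gamma_eq_zero_iff)
    then show ?thesis
      unfolding 1 2 3 using q by (simp add: power2_eq_square mult_ac)
  qed
  have nz: "?G ?u \<noteq> 0" "?G ?v \<noteq> 0" "Gamma ?u \<noteq> 0" "Gamma ?v \<noteq> 0"
    using nonpos by (auto simp: barnes_G_nonzero Gamma_eq_zero_iff)
  have "Determinant.det (jacobi_hankel n \<alpha> \<beta>)
     = (\<Prod>k\<le>n. pochhammer 1 k) * (\<Prod>k\<le>n. pochhammer ?a k) * (\<Prod>k\<le>n. pochhammer ?b k) * (\<Prod>k\<le>n. pochhammer s k)
       * ?u ^ N / ((2 ^ (2 * n)) ^ N * pochhammer ?u N * (\<Prod>k\<le>n. pochhammer ?u k)\<^sup>2 * (\<Prod>k\<le>n. pochhammer ?v k)\<^sup>2)"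
    unfolding det_jacobi_hankel[OF \<alpha> \<beta>] jacobi_pivot[OF \<alpha> \<beta> s_def s0(1)] lin[symmetric]
      prod_power_16[of n, folded N_def, symmetric]
    by (simp add: prod_dividef prod.distrib prod_power_distrib N_def power_divide)
  also have "\<dots> = (?G ?u)\<^sup>2 * (?G ?v)\<^sup>2 / (?G ?a * ?G ?b * ?G s)
     * (?u ^ N * (Gamma ?u ^ N * Gamma ?v ^ N)\<^sup>2 / ((2 ^ (2 * n)) ^ N * Gamma ?a ^ N * Gamma ?b ^ N * Gamma s ^ N))
     * (?G (real n + 2) * ?G (\<alpha> + real n + 2) * ?G (\<beta> + real n + 2) * ?G (s + real n + 1)
        / (pochhammer ?u N * (?G (?u + real n + 1))\<^sup>2 * (?G (?v + real n + 1))\<^sup>2))"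
    unfolding prods using nz by (simp add: power_divide power_mult_distrib mult_ac)
  also have "?u ^ N * (Gamma ?u ^ N * Gamma ?v ^ N)\<^sup>2 / ((2 ^ (2 * n)) ^ N * Gamma ?a ^ N * Gamma ?b ^ N * Gamma s ^ N)
     = (?u * (Gamma ?u * Gamma ?v)\<^sup>2 / (2 ^ (2 * n) * Gamma ?a * Gamma ?b * Gamma s)) ^ N"
    by (simp add: power_divide power_mult_distrib power_mult[symmetric] mult_ac)
  also note gamma[symmetric]
  finally show ?thesis
    unfolding jacobi_det_formula_def N_def s_def by (simp add: add_ac distrib_left)
qed

section \<open>Continuity in the parameters\<close>

text \<open>\<open>F\<close> is a continuous expression that coincides with \<open>f\<close> off the
  line; on the line its value is then the limit of \<open>f\<close>.\<close>

lemma has_extended_value_if_eq_off_line: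
  assumes "\<alpha> > -1" "\<beta> > -1"
    and eq: "\<And>a b. a > -1 \<Longrightarrow> b > -1 \<Longrightarrow> a + b \<noteq> -1 \<Longrightarrow> F a b = f a b"
    and lim: "((\<lambda>p. F (fst p) (snd p)) \<longlongrightarrow> F \<alpha> \<beta>) (at (\<alpha>, \<beta>))"
  shows "has_extended_value f \<alpha> \<beta> (F \<alpha> \<beta>)"
proof (cases "\<alpha> + \<beta> = -1")
  case True
  let ?S = "{(a, b). a + b \<noteq> (-1 :: real)}"
  have fst: "(fst \<longlongrightarrow> \<alpha>) (at (\<alpha>, \<beta>) within ?S)" and snd: "(snd \<longlongrightarrow> \<beta>) (at (\<alpha>, \<beta>) within ?S)"
    using tendsto_fst[OF tendsto_ident_at[of "(\<alpha>, \<beta>)" ?S]] tendsto_snd[OF tendsto_ident_at[of "(\<alpha>, \<beta>)" ?S]]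
    by simp_all
  \<comment> \<open>Near the point the bounds on both parameters persist, so the assumed equality
    applies at all nearby points of \<open>?S\<close>.\<close>
  have "eventually (\<lambda>p. p \<in> ?S) (at (\<alpha>, \<beta>) within ?S)"
    by (simp add: eventually_at_filter)
  with order_tendstoD(1)[OF fst assms(1)] order_tendstoD(1)[OF snd assms(2)]
  have "eventually (\<lambda>p. F (fst p) (snd p) = (case p of (a, b) \<Rightarrow> f a b)) (at (\<alpha>, \<beta>) within ?S)"
    by eventually_elim (auto intro!: eq)
  moreover have "((\<lambda>p. F (fst p) (snd p)) \<longlongrightarrow> F \<alpha> \<beta>) (at (\<alpha>, \<beta>) within ?S)"
    using lim by (rule tendsto_within_subset) simp
  ultimately show ?thesis
    using True by (simp add: has_extended_value_def Lim_transform_eventually)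
qed (use assms in \<open>simp add: has_extended_value_def\<close>)

lemma tendsto_pochhammer:
  fixes f :: "'a \<Rightarrow> real"
  assumes "(f \<longlongrightarrow> l) F"
  shows "((\<lambda>x. pochhammer (f x) k) \<longlongrightarrow> pochhammer l k) F"
  unfolding pochhammer_prod by (intro tendsto_intros assms)

context
  fixes \<alpha> \<beta> :: real
  assumes \<alpha>: "\<alpha> > -1" and \<beta>: "\<beta> > -1"
begin

lemma tendsto_jacobi_coeff:
  "((\<lambda>p. jacobi_coeff (fst p) (snd p) k i) \<longlongrightarrow> jacobi_coeff \<alpha> \<beta> k i) (at (\<alpha>, \<beta>))"
proof -
  have "pochhammer (\<alpha> + 1) i > 0"
    using \<alpha> by (intro pochhammer_pos) simp
  then show ?thesis
    unfolding jacobi_coeff_def by (auto intro!: tendsto_eq_intros tendsto_pochhammer)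
qed

text \<open>For \<open>k > 0\<close> the denominator is positive even where
  \<open>\<alpha> + \<beta> = -1\<close>, and for \<open>k = 0\<close> the norm is constant.\<close>

lemma tendsto_jacobi_sqnorm:
  "((\<lambda>p. jacobi_sqnorm (fst p) (snd p) k) \<longlongrightarrow> jacobi_sqnorm \<alpha> \<beta> k) (at (\<alpha>, \<beta>))"
proof (cases "k = 0")
  case False
  have "pochhammer (\<alpha> + 1) k > 0" "pochhammer (\<alpha> + \<beta> + 2) (k - 1) > 0"
    using \<alpha> \<beta> by (auto intro!: pochhammer_pos)
  moreover have "\<alpha> + \<beta> + 1 + 2 * real k > 0"
    using \<alpha> \<beta> False by simp
  ultimately show ?thesis
    unfolding jacobi_sqnorm_def using False by (auto intro!: tendsto_eq_intros tendsto_pochhammer)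
qed (simp add: jacobi_sqnorm_def)

end

theorem theorem2p5:
  fixes \<alpha> \<beta> :: real and n :: nat
  assumes "\<alpha> > -1" and "\<beta> > -1"
  shows "has_extended_value (jacobi_det_formula n) \<alpha> \<beta> (Determinant.det (jacobi_hankel n \<alpha> \<beta>))
    \<and> (\<exists>C \<in> carrier_mat (n + 1) (n + 1).
          inverts_mat (jacobi_hankel n \<alpha> \<beta>) C \<and> inverts_mat C (jacobi_hankel n \<alpha> \<beta>)
          \<and> (\<forall>i\<le>n. \<forall>j\<le>n. has_extended_value (jacobi_inverse_formula n i j) \<alpha> \<beta> (C $$ (i, j))))"
proof (intro conjI bexI[of _ "jacobi_inverse \<alpha> \<beta> n"] allI impI)
  \<comment> \<open>The continuous extension of the determinant formula is the product of
    pivots.\<close>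
  let ?d = "\<lambda>a b. \<Prod>k\<le>n. jacobi_sqnorm a b k / (jacobi_coeff a b k k)\<^sup>2"
  have "has_extended_value (jacobi_det_formula n) \<alpha> \<beta> (?d \<alpha> \<beta>)"
  proof (rule has_extended_value_if_eq_off_line[OF assms])
    show "?d a b = jacobi_det_formula n a b" if "a > -1" "b > -1" "a + b \<noteq> -1" for a b
      using det_jacobi_hankel[OF that(1,2), of n] det_jacobi_hankel_eq_formula[OF that, of n] by simp
    show "((\<lambda>p. ?d (fst p) (snd p)) \<longlongrightarrow> ?d \<alpha> \<beta>) (at (\<alpha>, \<beta>))"
      using jacobi_coeff_diag_nonzero[OF assms]
      by (intro tendsto_intros tendsto_jacobi_coeff tendsto_jacobi_sqnorm assms) auto
  qed
  then show "has_extended_value (jacobi_det_formula n) \<alpha> \<beta> (Determinant.det (jacobi_hankel n \<alpha> \<beta>))"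
    by (simp only: det_jacobi_hankel[OF assms])
next
  show "inverts_mat (jacobi_hankel n \<alpha> \<beta>) (jacobi_inverse \<alpha> \<beta> n)"
    "inverts_mat (jacobi_inverse \<alpha> \<beta> n) (jacobi_hankel n \<alpha> \<beta>)"
    using jacobi_inverse_inverts[OF assms, of n] jacobi_inverse_carrier[of \<alpha> \<beta> n] jacobi_mats_carrier(3)[of n \<alpha> \<beta>]
    by (auto simp: inverts_mat_def)
next
  fix i j assume ij: "i \<le> n" "j \<le> n"
  \<comment> \<open>The entry of \<open>L^T D^-1 L\<close> serves as the continuous extension of the
    inverse formula.\<close>
  let ?c = "\<lambda>a b. \<Sum>k\<le>n. jacobi_coeff a b k i * jacobi_coeff a b k j / jacobi_sqnorm a b k"
  have "has_extended_value (jacobi_inverse_formula n i j) \<alpha> \<beta> (?c \<alpha> \<beta>)"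
  proof (rule has_extended_value_if_eq_off_line[OF assms])
    show "?c a b = jacobi_inverse_formula n i j a b" if "a > -1" "b > -1" "a + b \<noteq> -1" for a b
      using jacobi_inverse_eq_formula[OF that ij] ij by (simp add: jacobi_inverse_index)
    show "((\<lambda>p. ?c (fst p) (snd p)) \<longlongrightarrow> ?c \<alpha> \<beta>) (at (\<alpha>, \<beta>))"
      using jacobi_sqnorm_pos[OF assms]
      by (intro tendsto_intros tendsto_jacobi_coeff tendsto_jacobi_sqnorm assms) (auto simp: less_imp_neq[symmetric])
  qed
  then show "has_extended_value (jacobi_inverse_formula n i j) \<alpha> \<beta> (jacobi_inverse \<alpha> \<beta> n $$ (i, j))"
    by (simp only: jacobi_inverse_index[OF ij])
qed (rule jacobi_inverse_carrier)

end
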